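(* Let $\mathbf{M}$ be a Markov process with state space $(S,\mathcal{S})$ and transition function $p^{t}(x,dy)$, $t\in\mathbb{T}$, $x\in S$. Assume that there is $\pi\in\mathcal{P}(S)$ satisfying $$\lim_{t\to\infty}d_W\big(p^{t}(x,dy),\pi(dy)\big)=0\qquad\text{for every } x\in S,$$ and that for every $f\in Lip(S)$ and $t\in\mathbb{T}$ the function $$F_{f,t}(x):=\int_S f(y)\,p^{t}(x,dy),\qquad x\in S,$$ is also in $Lip(S)$, with $|F_{f,t}|_{Lip}\le C_f$, where the constant $C_f$ depends only on $f$ (and not on $t$). Then, for every $p\ge1$, every $f\in Lip(S)$ and every $\mu\in\mathcal{P}(S)$, $$\frac{1}{t}\int_{[0,t)}f(M_s)\,\tau(ds)\longrightarrow \int_S f(y)\,\pi(dy)\qquad\text{in } L^p(\Omega,\mathbb{P}^{\mu})\ \text{ as } t\nearrow\infty,\ t\in\mathbb{T}.$$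
   Context: State space: $(S,d)$ is a non-empty Polish space, i.e. $d$ is a complete and separable metric on $S$, $\mathcal{S}$ is its Borel $\sigma$-algebra, and $d$ is bounded by $1$: $\sup_{x,y\in S}d(x,y)\le 1$. The time set $\mathbb{T}$ is either $\{0,1,2,\ldots\}$ or $[0,\infty)$, and $\tau$ is the counting measure on $\mathbb{T}$ in the first case and Lebesgue measure in the second. Process: $\mathbf{M}=(\Omega,\mathcal{F},\{\mathbb{P}^{x}\}_{x\in S},\{\mathcal{F}_t\}_{t\in\mathbb{T}},\{\theta_t\}_{t\in\mathbb{T}},\{M_t\}_{t\in\mathbb{T}})$ is a temporally homogeneous normal Markov process with state space $(S,\mathcal{S})$: each $(\Omega,\mathcal{F},\mathbb{P}^x)$ is a probability space; $\{\mathcal{F}_t\}$ is a filtration; $M_t:\Omega\to S$ is $\mathcal{F}_t/\mathcal{S}$-measurable; $\mathbb{P}^x(M_0=x)=1$ (normality); $x\mapsto\mathbb{P}^x(B)$ is $\mathcal{S}$-measurable for $B\in\mathcal{F}$; the shift operators $\theta_t:\Omega\to\Omega$ satisfy $M_t\circ\theta_s=M_{t+s}$; and the Markov property $\mathbb{P}^x(M_{t+s}\in B\mid\mathcal{F}_t)=p^s(M_t,B)$ $\mathbb{P}^x$-a.s. holds for all $s,t\in\mathbb{T}$, $x\in S$, $B\in\mathcal{S}$, where $p^{t}(x,dy):=\mathbb{P}^{x}(M_t\in dy)$ is the transition function. If $\mathbb{T}=[0,\infty)$, $\mathbf{M}$ is assumed progressively measurable: for each $t\ge0$ the map $(s,\omega)\mapsto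 M_s(\omega)$ from $[0,t]\times\Omega$ to $S$ is $\mathcal{B}([0,t])\times\mathcal{F}_t/\mathcal{S}$-measurable. $\mathcal{P}(S)$ is the set of probability measures on $\mathcal{S}$; for $\mu\in\mathcal{P}(S)$, $\mathbb{P}^\mu(d\omega):=\int_S\mathbb{P}^y(d\omega)\,\mu(dy)$. $Lip(S)$ is the space of all $f:S\to\mathbb{R}$ for which there is $L_f\ge0$ with $|f(x)-f(y)|\le L_f\,d(x,y)$ for all $x,y\in S$; the best constant is denoted $|f|_{Lip}$. Since $d\le1$, every $f\in Lip(S)$ is bounded. The $L^1$-Wasserstein metric on $\mathcal{P}(S)$ is $$d_W(\mu,\nu):=\sup_{f\in Lip(S),\,|f|_{Lip}\le1}\left|\int_S f\,d\mu-\int_S f\,d\nu\right|.$$ *)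

theory Defs
  imports "HOL-Probability.Probability"
begin

text \<open>
  Both time sets are treated as sets of real numbers, so that discrete and continuous time share
  one statement.  The Polish state space is the whole of a type of class \<open>polish_space\<close>
  with \<open>d = dist\<close>.
\<close>

definition time_set :: "real set \<Rightarrow> real measure \<Rightarrow> bool" where
  "time_set T \<tau> \<longleftrightarrow>
     (T = \<nat> \<and> \<tau> = count_space \<nat>) \<or> (T = {0..} \<and> \<tau> = restrict_space lborel {0..})"

definition Lip :: "('a::metric_space \<Rightarrow> real) set" where
  "Lip = {f. \<exists>L. L-lipschitz_on UNIV f}"

text \<open>The best Lipschitz constant; meaningful for members of \<open>Lip\<close> only.\<close>

definition lip_seminorm :: "('a::metric_space \<Rightarrow> real) \<Rightarrow> real" where
  "lip_seminorm f = Inf {L. L-lipschitz_on UNIV f}"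

text \<open>
  The supremum is taken in the reals.  For probability measures on a space of diameter at most 1
  it ranges over a nonempty subset of \<open>{0..1}\<close>, so it is a genuine supremum there.
\<close>

definition wasserstein_dist :: "'a::metric_space measure \<Rightarrow> 'a measure \<Rightarrow> real" where
  "wasserstein_dist \<mu> \<nu> =
     (SUP f\<in>{f \<in> Lip. lip_seminorm f \<le> 1}. \<bar>(\<integral>x. f x \<partial>\<mu>) - (\<integral>x. f x \<partial>\<nu>)\<bar>)"

definition transition ::
  "('a::topological_space \<Rightarrow> 'w measure) \<Rightarrow> (real \<Rightarrow> 'w \<Rightarrow> 'a) \<Rightarrow> real \<Rightarrow> 'a \<Rightarrow> 'a measure" where
  "transition P M t x = distr (P x) borel (M t)"

text \<open>
  \<open>\<F>\<close> and \<open>\<F>t t\<close> only serve as measurable spaces: of these measures, just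
  \<open>space\<close> and \<open>sets\<close> matter.  The families \<open>\<F>t\<close>, \<open>\<theta>\<close> and \<open>M\<close>
  are constrained for times in \<open>T\<close> only.
\<close>

locale markov_process =
  fixes T :: "real set"
    and \<F> :: "'w measure"
    and P :: "'a::polish_space \<Rightarrow> 'w measure"
    and \<F>t :: "real \<Rightarrow> 'w measure"
    and \<theta> :: "real \<Rightarrow> 'w \<Rightarrow> 'w"
    and M :: "real \<Rightarrow> 'w \<Rightarrow> 'a"
  assumes prob_space_P: "\<And>x. prob_space (P x)"
    and sets_P: "\<And>x. sets (P x) = sets \<F>"
    and kernel_measurable: "\<And>B. B \<in> sets \<F> \<Longrightarrow> (\<lambda>x. measure (P x) B) \<in> borel_measurable borel"
    and filtration_sub: "\<And>t. t \<in> T \<Longrightarrow> subalgebra \<F> (\<F>t t)"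
    and filtration_mono: "\<And>s t. s \<in> T \<Longrightarrow> t \<in> T \<Longrightarrow> s \<le> t \<Longrightarrow> subalgebra (\<F>t t) (\<F>t s)"
    and adapted: "\<And>t. t \<in> T \<Longrightarrow> M t \<in> measurable (\<F>t t) borel"
    and normal: "\<And>x. measure (P x) {\<omega> \<in> space \<F>. M 0 \<omega> = x} = 1"
    and shift_space: "\<And>s \<omega>. s \<in> T \<Longrightarrow> \<omega> \<in> space \<F> \<Longrightarrow> \<theta> s \<omega> \<in> space \<F>"
    and shift: "\<And>s t \<omega>. s \<in> T \<Longrightarrow> t \<in> T \<Longrightarrow> \<omega> \<in> space \<F> \<Longrightarrow> M t (\<theta> s \<omega>) = M (t + s) \<omega>"
    and markov: "\<And>s t x B. s \<in> T \<Longrightarrow> t \<in> T \<Longrightarrow> B \<in> sets borel \<Longrightarrow>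
      AE \<omega> in P x.
        real_cond_exp (P x) (\<F>t t) (indicat_real {\<omega> \<in> space \<F>. M (t + s) \<omega> \<in> B}) \<omega>
          = measure (transition P M s (M t \<omega>)) B"
    and progressive: "\<And>t. T = {0..} \<Longrightarrow> 0 \<le> t \<Longrightarrow>
      (\<lambda>(s, \<omega>). M s \<omega>) \<in> measurable (restrict_space borel {0..t} \<Otimes>\<^sub>M \<F>t t) borel"

definition in_Lp :: "'w measure \<Rightarrow> real \<Rightarrow> ('w \<Rightarrow> real) \<Rightarrow> bool" where
  "in_Lp N p X \<longleftrightarrow> X \<in> borel_measurable N \<and> integrable N (\<lambda>\<omega>. \<bar>X \<omega>\<bar> powr p)"

definition Lp_norm :: "'w measure \<Rightarrow> real \<Rightarrow> ('w \<Rightarrow> real) \<Rightarrow> real" where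
  "Lp_norm N p X = (\<integral>\<omega>. \<bar>X \<omega>\<bar> powr p \<partial>N) powr (1 / p)"

text \<open>Membership is required explicitly because the Bochner integral is 0 for non-integrable functions.\<close>

definition tendsto_Lp ::
  "'w measure \<Rightarrow> real \<Rightarrow> ('i \<Rightarrow> 'w \<Rightarrow> real) \<Rightarrow> ('w \<Rightarrow> real) \<Rightarrow> 'i filter \<Rightarrow> bool" where
  "tendsto_Lp N p X Y G \<longleftrightarrow>
     in_Lp N p Y \<and> (\<forall>\<^sub>F i in G. in_Lp N p (X i)) \<and>
     ((\<lambda>i. Lp_norm N p (\<lambda>\<omega>. X i \<omega> - Y \<omega>)) \<longlongrightarrow> 0) G"

end

theory Submission
  imports Defs
begin

text \<open>
  Replacing \<open>f\<close> by \<open>g = f - \<pi>(f)\<close>, it suffices to treat mean zero.  By the Markov property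
  \<open>\<bar>E[g(M\<^sub>s) g(M\<^sub>s\<^sub>+\<^sub>u)]\<bar>\<close> is at most a constant times \<open>E h\<^sub>u(M\<^sub>s)\<close>, where
  \<open>h\<^sub>u = \<bar>p\<^sup>u g\<bar>\<close>.  The functions \<open>h\<^sub>u\<close> share one Lipschitz constant, so for large \<open>s\<close>
  this expectation is close to \<open>\<pi>(h\<^sub>u)\<close> uniformly in \<open>u\<close>; and \<open>\<pi>(h\<^sub>u) \<longrightarrow> 0\<close> by dominated
  convergence, because \<open>h\<^sub>u \<longrightarrow> 0\<close> pointwise.  Thus \<open>g(M\<^sub>s)\<close> and \<open>g(M\<^sub>r)\<close> are nearly uncorrelated
  unless \<open>s\<close>, \<open>r\<close> or \<open>\<bar>r - s\<bar>\<close> is bounded, and the second moment of the time average tends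
  to zero under every \<open>P x\<close>.  Dominated convergence in \<open>x\<close> gives the same under \<open>\<mu> \<bind> P\<close>, and
  uniform boundedness upgrades \<open>L\<^sup>2\<close> to \<open>L\<^sup>p\<close>.
\<close>

subsection \<open>Lipschitz functions and the Wasserstein distance\<close>

text \<open>The infimum of the admissible constants is attained: at two distinct points the
  difference quotient is a lower bound of all these constants, hence also of their infimum.\<close>

lemma lipschitz_on_lip_seminorm:
  assumes "f \<in> Lip"
  shows "(lip_seminorm f)-lipschitz_on UNIV f"
proof (rule lipschitz_onI)
  let ?A = "{L. L-lipschitz_on UNIV f}"
  have ne: "?A \<noteq> {}" using assms by (auto simp: Lip_def)
  show nonneg: "0 \<le> lip_seminorm f"
    unfolding lip_seminorm_def using ne by (intro cInf_greatest) (auto intro: lipschitz_on_nonneg)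
  fix x y
  show "dist (f x) (f y) \<le> lip_seminorm f * dist x y"
  proof (cases "x = y")
    case False
    then have pos: "dist x y > 0" by simp
    have "dist (f x) (f y) / dist x y \<le> Inf ?A"
      using ne pos by (intro cInf_greatest) (auto simp: pos_divide_le_eq dest: lipschitz_onD)
    then show ?thesis using pos by (simp add: lip_seminorm_def pos_divide_le_eq)
  qed simp
qed

lemma lip_seminorm_le:
  assumes "C-lipschitz_on UNIV f"
  shows "lip_seminorm f \<le> C"
  unfolding lip_seminorm_def
  using assms by (intro cInf_lower) (auto intro!: bdd_belowI[of _ 0] lipschitz_on_nonneg)

lemma lipschitz_borel_measurable:
  assumes "C-lipschitz_on UNIV f"
  shows "f \<in> borel_measurable borel"
  using assms by (intro borel_measurable_continuous_onI lipschitz_on_continuous_on)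

section \<open>Integrals of bounded and of Lipschitz functions\<close>

lemma finite_measure_integrable_bounded:
  fixes h :: "'a \<Rightarrow> real"
  assumes "finite_measure N" "h \<in> borel_measurable N" "\<And>x. \<bar>h x\<bar> \<le> K"
  shows "integrable N h"
  using assms by (intro finite_measure.integrable_const_bound[where B=K]) auto

text \<open>If \<open>h\<close> is not integrable, its Bochner integral is 0 while \<open>K\<close>
  is nonnegative. Bounds obtained from this hold at every sample point, also outside the sample
  space.\<close>

lemma finite_abs_integral_le:
  fixes h :: "'a \<Rightarrow> real"
  assumes N: "finite_measure N" and b: "\<And>x. \<bar>h x\<bar> \<le> K"
  shows "\<bar>\<integral>x. h x \<partial>N\<bar> \<le> K * measure N (space N)"
proof (cases "integrable N h")
  case True
  interpret finite_measure N by fact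
  have "\<bar>\<integral>x. h x \<partial>N\<bar> \<le> (\<integral>x. \<bar>h x\<bar> \<partial>N)" by (rule integral_abs_bound)
  also have "\<dots> \<le> (\<integral>x. K \<partial>N)" using True b by (intro integral_mono) auto
  finally show ?thesis by (simp add: mult.commute)
next
  case False
  have "0 \<le> K" using b[of undefined] by linarith
  with False show ?thesis by (simp add: not_integrable_integral_eq)
qed

lemma prob_abs_integral_le:
  fixes h :: "'a \<Rightarrow> real"
  assumes "prob_space N" "\<And>x. \<bar>h x\<bar> \<le> K"
  shows "\<bar>\<integral>x. h x \<partial>N\<bar> \<le> K"
  using finite_abs_integral_le[of N h K, OF prob_space.finite_measure] assms
  by (simp add: prob_space.prob_space)

lemma lipschitz_bounded:
  fixes f :: "'a::metric_space \<Rightarrow> real"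
  assumes "\<And>x y::'a. dist x y \<le> 1" "C-lipschitz_on UNIV f"
  shows "\<bar>f x - f y\<bar> \<le> C"
proof -
  have "\<bar>f x - f y\<bar> \<le> C * dist x y"
    using lipschitz_onD[OF assms(2), of x y] by (simp add: dist_real_def)
  also have "\<dots> \<le> C * 1"
    using assms lipschitz_on_nonneg by (intro mult_left_mono) auto
  finally show ?thesis by simp
qed

lemma lipschitz_integrable:
  fixes h :: "'a::metric_space \<Rightarrow> real"
  assumes d1: "\<And>x y::'a. dist x y \<le> 1"
    and N: "prob_space N" "sets N = sets borel" and h: "C-lipschitz_on UNIV h"
  shows "integrable N h"
proof (rule finite_measure_integrable_bounded)
  show "finite_measure N" using N(1) by (rule prob_space.finite_measure)
  show "h \<in> borel_measurable N"
    using lipschitz_borel_measurable[OF h] N(2) by (simp cong: measurable_cong_sets)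
  show "\<bar>h x\<bar> \<le> C + \<bar>h undefined\<bar>" for x
    using lipschitz_bounded[OF d1 h, of x undefined] by linarith
qed

lemma abs_integral_sub_le:
  fixes h :: "'a \<Rightarrow> real"
  assumes N: "prob_space N" and h: "integrable N h" and b: "\<And>x. \<bar>h x - c\<bar> \<le> C"
  shows "\<bar>(\<integral>x. h x \<partial>N) - c\<bar> \<le> C"
proof -
  interpret prob_space N by fact
  have "\<bar>\<integral>x. h x - c \<partial>N\<bar> \<le> C"
    using h b by (intro prob_abs_integral_le N) auto
  then show ?thesis using h by (simp add: prob_space)
qed

text \<open>As distances are at most 1, \<open>h\<close> oscillates by at most \<open>C\<close>, so
  it stays within \<open>C\<close> of its own mean. For a function of mean zero this becomes a
  uniform bound by its Lipschitz constant.\<close>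

lemma lipschitz_deviation_le:
  fixes h :: "'a::metric_space \<Rightarrow> real"
  assumes d1: "\<And>x y::'a. dist x y \<le> 1"
    and N: "prob_space N" "sets N = sets borel" and h: "C-lipschitz_on UNIV h"
  shows "\<bar>h x - (\<integral>y. h y \<partial>N)\<bar> \<le> C"
  using abs_integral_sub_le[OF N(1) lipschitz_integrable[OF d1 N h] lipschitz_bounded[OF d1 h]]
  by (simp add: abs_minus_commute)

lemma lipschitz_integral_diff_le:
  fixes h :: "'a::metric_space \<Rightarrow> real"
  assumes d1: "\<And>x y::'a. dist x y \<le> 1"
    and \<mu>: "prob_space \<mu>" "sets \<mu> = sets borel" and \<nu>: "prob_space \<nu>" "sets \<nu> = sets borel"
    and h: "C-lipschitz_on UNIV h"
  shows "\<bar>(\<integral>x. h x \<partial>\<mu>) - (\<integral>x. h x \<partial>\<nu>)\<bar> \<le> C"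
  using abs_integral_sub_le[OF \<mu>(1) lipschitz_integrable[OF d1 \<mu> h]
    lipschitz_deviation_le[OF d1 \<nu> h]] .

text \<open>Dividing by \<open>C\<close> makes \<open>h\<close> a competitor in the supremum. The
  case \<open>C = 0\<close> is separate because it rules out the division; there both integrals
  agree.\<close>

lemma lipschitz_integral_diff_le_wasserstein:
  fixes h :: "'a::metric_space \<Rightarrow> real"
  assumes d1: "\<And>x y::'a. dist x y \<le> 1"
    and \<mu>: "prob_space \<mu>" "sets \<mu> = sets borel" and \<nu>: "prob_space \<nu>" "sets \<nu> = sets borel"
    and h: "C-lipschitz_on UNIV h"
  shows "\<bar>(\<integral>x. h x \<partial>\<mu>) - (\<integral>x. h x \<partial>\<nu>)\<bar> \<le> C * wasserstein_dist \<mu> \<nu>"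
proof (cases "C = 0")
  case True
  then show ?thesis using lipschitz_integral_diff_le[OF assms] by simp
next
  case False
  then have C: "C > 0" using lipschitz_on_nonneg[OF h] by simp
  define g where "g x = h x / C" for x
  have g: "1-lipschitz_on UNIV g"
    using C lipschitz_onD[OF h]
    by (intro lipschitz_onI) (auto simp: g_def dist_real_def field_simps simp flip: diff_divide_distrib)
  \<comment> \<open>A supremum in the reals dominates its members only if these are bounded above;
    here the diameter bound gives 1.\<close>
  have bdd: "bdd_above ((\<lambda>f. \<bar>(\<integral>x. f x \<partial>\<mu>) - (\<integral>x. f x \<partial>\<nu>)\<bar>) ` {f \<in> Lip. lip_seminorm f \<le> 1})"
    using lipschitz_integral_diff_le[OF d1 \<mu> \<nu> lipschitz_on_lip_seminorm]
    by (intro bdd_aboveI2[where M=1]) (auto intro: order_trans)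
  have "\<bar>(\<integral>x. g x \<partial>\<mu>) - (\<integral>x. g x \<partial>\<nu>)\<bar> \<le> wasserstein_dist \<mu> \<nu>"
    unfolding wasserstein_dist_def using g lip_seminorm_le[OF g]
    by (intro cSUP_upper[OF _ bdd]) (auto simp: Lip_def)
  then show ?thesis
    using C by (simp add: g_def field_simps flip: diff_divide_distrib)
qed

subsection \<open>Second moments and limits of integrals\<close>

text \<open>Expand the square into a double time integral of covariances. Pairs of late, well
  separated times contribute at most \<epsilon> each. All other pairs lie in three strips
  (\<open>s\<close> early, \<open>r\<close> early, \<open>s\<close> and \<open>r\<close> close),
  each of mass at most \<open>b\<close> times the total mass, and there the covariance is at most
  \<open>K\<^sup>2\<close>; hence the factor 3.\<close>

lemma second_moment_integral_le:
  fixes Z :: "real \<Rightarrow> 'w \<Rightarrow> real"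
  assumes \<nu>: "finite_measure \<nu>" and N: "prob_space N"
    and id[measurable]: "(\<lambda>s. s) \<in> borel_measurable \<nu>"
    and Z[measurable]: "case_prod Z \<in> borel_measurable (\<nu> \<Otimes>\<^sub>M N)"
    and bound: "\<And>s \<omega>. \<bar>Z s \<omega>\<bar> \<le> K"
    and early: "measure \<nu> {s \<in> space \<nu>. s < d} \<le> b"
    and close: "\<And>s. s \<in> space \<nu> \<Longrightarrow> measure \<nu> {r \<in> space \<nu>. \<bar>r - s\<bar> < d} \<le> b"
    and cov: "\<And>s r. s \<in> space \<nu> \<Longrightarrow> r \<in> space \<nu> \<Longrightarrow> d \<le> s \<Longrightarrow> s + d \<le> r \<Longrightarrow>
      \<bar>\<integral>\<omega>. Z s \<omega> * Z r \<omega> \<partial>N\<bar> \<le> \<epsilon>"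
    and "0 \<le> \<epsilon>"
  shows "(\<integral>\<omega>. (\<integral>s. Z s \<omega> \<partial>\<nu>)\<^sup>2 \<partial>N)
    \<le> \<epsilon> * (measure \<nu> (space \<nu>))\<^sup>2 + 3 * K\<^sup>2 * b * measure \<nu> (space \<nu>)"
proof -
  interpret N: prob_space N by fact
  interpret \<nu>: finite_measure \<nu> by fact
  interpret pair: pair_sigma_finite \<nu> N ..
  have fin: "finite_measure (\<nu> \<Otimes>\<^sub>M N)"
    by (rule finite_measure_pair_measure) (unfold_locales)
  define m where "m = measure \<nu> (space \<nu>)"
  define I where "I \<omega> = (\<integral>r. Z r \<omega> \<partial>\<nu>)" for \<omega>
  have K0: "0 \<le> K" using bound[of undefined undefined] by linarith
  have m0: "0 \<le> m" unfolding m_def by simp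
  have sq: "\<bar>x * y\<bar> \<le> K\<^sup>2" if "\<bar>x\<bar> \<le> K" "\<bar>y\<bar> \<le> K" for x y :: real
    using mult_mono[OF that K0 abs_ge_zero] by (simp add: abs_mult power2_eq_square)
  have [measurable]: "Z s \<in> borel_measurable N" if "s \<in> space \<nu>" for s
    using that by measurable
  have Zsnd[measurable]: "(\<lambda>s. Z s \<omega>) \<in> borel_measurable \<nu>" if "\<omega> \<in> space N" for \<omega>
    using that by measurable
  have I_meas[measurable]: "I \<in> borel_measurable N"
    unfolding I_def by measurable
  have I_bound: "\<bar>I \<omega>\<bar> \<le> K * m" for \<omega>
    unfolding I_def m_def using bound by (intro finite_abs_integral_le \<nu>)
  define q where "q s r = (\<integral>\<omega>. Z s \<omega> * Z r \<omega> \<partial>N)" for s r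
  \<comment> \<open>An explicit majorant of \<open>\<bar>q s r\<bar>\<close>: the good pairs give
    \<epsilon>, and each strip adds \<open>K\<^sup>2\<close>. Overlaps of strips are counted
    repeatedly, which only enlarges it.\<close>
  define e where "e s r = \<epsilon> + K\<^sup>2 * (indicator {..<d} s + indicator {..<d} r + indicator {r. \<bar>r - s\<bar> < d} r)" for s r :: real
  have q: "\<bar>q s r\<bar> \<le> e s r" if s: "s \<in> space \<nu>" and r: "r \<in> space \<nu>" for s r
  proof (cases "d \<le> s \<and> d \<le> r \<and> d \<le> \<bar>r - s\<bar>")
    case True
    then have "\<bar>q s r\<bar> \<le> \<epsilon>"
      \<comment> \<open>The bound \<open>cov\<close> is for ordered times; symmetry of the product
        covers \<open>r < s\<close>.\<close>
      using cov[OF s r] cov[OF r s] by (cases "s \<le> r") (auto simp: q_def mult.commute)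
    also have "\<dots> \<le> e s r" unfolding e_def by (simp add: indicator_def)
    finally show ?thesis .
  next
    case False
    have "integrable N (\<lambda>\<omega>. Z s \<omega> * Z r \<omega>)"
      using s r sq[OF bound bound] by (intro finite_measure_integrable_bounded[where K="K\<^sup>2"] N.finite_measure_axioms) auto
    then have "(\<integral>\<omega>. \<bar>Z s \<omega> * Z r \<omega>\<bar> \<partial>N) \<le> (\<integral>\<omega>. K\<^sup>2 \<partial>N)"
      using sq[OF bound bound] by (intro integral_mono) auto
    then have "\<bar>q s r\<bar> \<le> K\<^sup>2"
      unfolding q_def by (intro order_trans[OF integral_abs_bound]) (simp add: N.prob_space)
    also have "\<dots> \<le> \<epsilon> + K\<^sup>2 * 1" using \<open>0 \<le> \<epsilon>\<close> by simp
    also have "\<dots> \<le> e s r"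
      unfolding e_def using False by (intro add_left_mono mult_left_mono) (auto simp: indicator_def)
    finally show ?thesis .
  qed
  have sets_eq: "{..<d} \<inter> space \<nu> = {s \<in> space \<nu>. s < d}"
    "{r. \<bar>r - s\<bar> < d} \<inter> space \<nu> = {r \<in> space \<nu>. \<bar>r - s\<bar> < d}" for s
    by auto
  \<comment> \<open>The two factors of the squared integral are expanded one after the other: here
    \<open>I\<close> over \<open>r\<close> with \<open>s\<close> fixed, later the remaining factor
    over \<open>s\<close>. Each time Fubini on \<nu> and \<open>N\<close> suffices.\<close>
  have ZI_le: "\<bar>\<integral>\<omega>. Z s \<omega> * I \<omega> \<partial>N\<bar> \<le> \<epsilon> * m + K\<^sup>2 * (m * indicator {..<d} s + b + b)"
    if s[measurable]: "s \<in> space \<nu>" for s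
  proof -
    have "integrable (\<nu> \<Otimes>\<^sub>M N) (case_prod (\<lambda>r \<omega>. Z s \<omega> * Z r \<omega>))"
      using sq[OF bound bound] by (intro finite_measure_integrable_bounded[where K="K\<^sup>2"] fin) (auto)
    from pair.Fubini_integral[OF this]
    have *: "(\<integral>\<omega>. Z s \<omega> * I \<omega> \<partial>N) = (\<integral>r. q s r \<partial>\<nu>)"
      by (simp add: I_def q_def)
    have [simp]: "integrable \<nu> (\<lambda>r. indicator {..<d} r :: real)" "integrable \<nu> (\<lambda>r. indicator {r. \<bar>r - s\<bar> < d} r :: real)"
      by (auto intro!: finite_measure_integrable_bounded[where K=1] \<nu> simp: indicator_def)
    have "\<bar>\<integral>r. q s r \<partial>\<nu>\<bar> \<le> (\<integral>r. \<bar>q s r\<bar> \<partial>\<nu>)" by (rule integral_abs_bound)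
    also have "\<dots> \<le> (\<integral>r. e s r \<partial>\<nu>)"
      using q[OF s] by (intro integral_mono') (auto simp: e_def intro: order_trans[OF abs_ge_zero])
    also have "\<dots> = \<epsilon> * m + K\<^sup>2 * (m * indicator {..<d} s + measure \<nu> {r \<in> space \<nu>. r < d} + measure \<nu> {r \<in> space \<nu>. \<bar>r - s\<bar> < d})"
      unfolding e_def by (simp add: m_def sets_eq algebra_simps)
    also have "\<dots> \<le> \<epsilon> * m + K\<^sup>2 * (m * indicator {..<d} s + b + b)"
      using early close[OF s] by (intro add_left_mono mult_left_mono add_mono) auto
    finally show ?thesis by (simp add: *)
  qed
  have "\<bar>x * y\<bar> \<le> K * (K * m)" if "\<bar>x\<bar> \<le> K" "\<bar>y\<bar> \<le> K * m" for x y :: real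
    using mult_mono[OF that K0 abs_ge_zero] by (simp add: abs_mult)
  then have *: "integrable (\<nu> \<Otimes>\<^sub>M N) (case_prod (\<lambda>s \<omega>. Z s \<omega> * I \<omega>))"
    using bound I_bound by (intro finite_measure_integrable_bounded[where K="K * (K * m)"] fin) auto
  \<comment> \<open>The monotonicity rule \<open>integral_mono'\<close> wants a nonnegative
    majorant.\<close>
  have b0: "0 \<le> b" using early measure_nonneg order_trans by blast
  have [simp]: "integrable \<nu> (\<lambda>r. indicator {..<d} r :: real)"
    by (auto intro!: finite_measure_integrable_bounded[where K=1] \<nu> simp: indicator_def)
  from pair.Fubini_integral[OF *]
  have "(\<integral>\<omega>. (I \<omega>)\<^sup>2 \<partial>N) = (\<integral>s. (\<integral>\<omega>. Z s \<omega> * I \<omega> \<partial>N) \<partial>\<nu>)"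
    by (simp add: I_def power2_eq_square)
  also have "\<dots> \<le> (\<integral>s. \<epsilon> * m + K\<^sup>2 * (m * indicator {..<d} s + b + b) \<partial>\<nu>)"
    using ZI_le b0 m0 \<open>0 \<le> \<epsilon>\<close> by (intro integral_mono') (auto intro: abs_le_D1)
  also have "\<dots> = \<epsilon> * m * m + K\<^sup>2 * (m * measure \<nu> {s \<in> space \<nu>. s < d} + m * b + m * b)"
    by (simp add: m_def sets_eq algebra_simps)
  also have "\<dots> \<le> \<epsilon> * m * m + K\<^sup>2 * (m * b + m * b + m * b)"
    using early m0 by (intro add_left_mono mult_left_mono add_right_mono) auto
  finally show ?thesis
    by (simp add: I_def m_def power2_eq_square algebra_simps)
qed

text \<open>Reduces limits along \<open>T\<close> to sequences, the form in which dominated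
  convergence is applied. If the limit failed, bad times beyond each \<open>n\<close> would form a
  sequence in \<open>T\<close> tending to infinity.\<close>

lemma filterlim_at_top_within_sequentially:
  fixes T :: "real set"
  assumes "\<And>X :: nat \<Rightarrow> real. (\<And>n. X n \<in> T) \<Longrightarrow> filterlim X at_top sequentially \<Longrightarrow> filterlim (\<lambda>n. a (X n)) G sequentially"
  shows "filterlim a G (inf at_top (principal T))"
  unfolding filterlim_iff
proof (intro allI impI, rule ccontr)
  fix Q assume Q: "eventually Q G" and neg: "\<not> (\<forall>\<^sub>F t in inf at_top (principal T). Q (a t))"
  then have "\<forall>n::nat. \<exists>t. real n \<le> t \<and> t \<in> T \<and> \<not> Q (a t)"
    by (auto simp: eventually_inf_principal eventually_at_top_linorder)
  then obtain X where X: "\<And>n. real n \<le> X n" "\<And>n. X n \<in> T" "\<And>n. \<not> Q (a (X n))" by metis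
  have "filterlim X at_top sequentially"
    by (rule filterlim_at_top_mono[OF filterlim_real_sequentially]) (simp add: X)
  from assms[OF X(2) this] Q have "\<forall>\<^sub>F n in sequentially. Q (a (X n))" by (auto simp: filterlim_iff)
  with X(3) show False by simp
qed

lemma filterlim_within_compose:
  fixes T :: "real set"
  assumes "filterlim a G (inf at_top (principal T))" "\<And>n. X n \<in> T" "filterlim X at_top sequentially"
  shows "filterlim (\<lambda>n. a (X n)) G sequentially"
proof -
  have "filterlim X (inf at_top (principal T)) sequentially"
    using assms(2,3) by (simp add: filterlim_inf filterlim_principal)
  then show ?thesis using filterlim_compose[OF assms(1)] by blast
qed

lemma integral_tendsto_zero_within:
  fixes h :: "real \<Rightarrow> 'a \<Rightarrow> real"
  assumes N: "finite_measure N"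
    and meas: "\<And>t. t \<in> T \<Longrightarrow> h t \<in> borel_measurable N"
    and bound: "\<And>t x. t \<in> T \<Longrightarrow> \<bar>h t x\<bar> \<le> K"
    and lim: "\<And>x. ((\<lambda>t. h t x) \<longlongrightarrow> 0) (inf at_top (principal T))"
  shows "((\<lambda>t. \<integral>x. h t x \<partial>N) \<longlongrightarrow> 0) (inf at_top (principal T))"
proof (rule filterlim_at_top_within_sequentially)
  fix X :: "nat \<Rightarrow> real" assume X: "\<And>n. X n \<in> T" "filterlim X at_top sequentially"
  have "(\<lambda>n. \<integral>x. h (X n) x \<partial>N) \<longlonglongrightarrow> (\<integral>x. 0 \<partial>N)"
    using meas[OF X(1)] bound[OF X(1)] filterlim_within_compose[OF lim X]
    by (intro integral_dominated_convergence[where w="\<lambda>_. K"] finite_measure.integrable_const N) auto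
  then show "(\<lambda>n. \<integral>x. h (X n) x \<partial>N) \<longlonglongrightarrow> 0" by simp
qed

text \<open>The identity is obtained for nonnegative integrals, where mixtures disintegrate
  directly; the bound \<open>K\<close> keeps the inner integrals finite, so that they can be read as
  real integrals again.\<close>

lemma integral_bind_prob_kernel:
  fixes h :: "'w \<Rightarrow> real"
  assumes \<mu>: "prob_space \<mu>" "sets \<mu> = sets N" and P: "P \<in> N \<rightarrow>\<^sub>M prob_algebra R"
    and h: "h \<in> borel_measurable R" "\<And>\<omega>. 0 \<le> h \<omega>" "\<And>\<omega>. h \<omega> \<le> K"
  shows "(\<integral>\<omega>. h \<omega> \<partial>(\<mu> \<bind> P)) = (\<integral>x. (\<integral>\<omega>. h \<omega> \<partial>P x) \<partial>\<mu>)"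
proof -
  have P_sub: "P \<in> \<mu> \<rightarrow>\<^sub>M subprob_algebra R"
    using measurable_prob_algebraD[OF P] \<mu>(2) by (simp cong: measurable_cong_sets)
  note [measurable] = P_sub h(1)
  have Px: "prob_space (P x)" "sets (P x) = sets R" if "x \<in> space \<mu>" for x
    using that measurable_space[OF P, of x] sets_eq_imp_space_eq[OF \<mu>(2)] by (auto simp: space_prob_algebra)
  have "sets (\<mu> \<bind> P) = sets R"
    using P_sub \<mu>(1) by (intro sets_bind Px(2)) (auto dest: prob_space.not_empty)
  then have "(\<integral>\<omega>. h \<omega> \<partial>(\<mu> \<bind> P)) = enn2real (\<integral>\<^sup>+\<omega>. ennreal (h \<omega>) \<partial>(\<mu> \<bind> P))"
    using h by (intro integral_eq_nn_integral) (auto cong: measurable_cong_sets)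
  also have "(\<integral>\<^sup>+\<omega>. ennreal (h \<omega>) \<partial>(\<mu> \<bind> P)) = (\<integral>\<^sup>+x. (\<integral>\<^sup>+\<omega>. ennreal (h \<omega>) \<partial>P x) \<partial>\<mu>)"
    by (rule nn_integral_bind[OF _ P_sub]) measurable
  also have "\<dots> = (\<integral>\<^sup>+x. ennreal (\<integral>\<omega>. h \<omega> \<partial>P x) \<partial>\<mu>)"
  proof (intro nn_integral_cong nn_integral_eq_integral)
    fix x assume x: "x \<in> space \<mu>"
    show "integrable (P x) h"
      using h Px[OF x] by (intro finite_measure_integrable_bounded[where K=K] prob_space.finite_measure)
        (auto simp: abs_of_nonneg cong: measurable_cong_sets)
  qed (use h in auto)
  also have "enn2real \<dots> = (\<integral>x. (\<integral>\<omega>. h \<omega> \<partial>P x) \<partial>\<mu>)"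
    using h by (intro integral_eq_nn_integral[symmetric]) auto
  finally show ?thesis .
qed

text \<open>By boundedness the \<open>p\<close>-th power of \<open>\<bar>A\<bar>\<close> is at most
  \<open>K powr (p - 1)\<close> times \<open>\<bar>A\<bar>\<close>, and the first moment is at most
  the root of the second. This treats all \<open>p\<close> at least 1 at once.\<close>

lemma powr_moment_tendsto_zero:
  fixes A :: "'i \<Rightarrow> 'w \<Rightarrow> real"
  assumes N: "prob_space N" and p: "1 \<le> p"
    and A: "\<forall>\<^sub>F i in G. A i \<in> borel_measurable N" "\<And>i \<omega>. \<bar>A i \<omega>\<bar> \<le> K"
    and lim: "((\<lambda>i. \<integral>\<omega>. (A i \<omega>)\<^sup>2 \<partial>N) \<longlongrightarrow> 0) G"
  shows "((\<lambda>i. \<integral>\<omega>. \<bar>A i \<omega>\<bar> powr p \<partial>N) \<longlongrightarrow> 0) G"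
proof (rule Lim_null_comparison)
  interpret prob_space N by fact
  show "((\<lambda>i. K powr (p - 1) * sqrt (\<integral>\<omega>. (A i \<omega>)\<^sup>2 \<partial>N)) \<longlongrightarrow> 0) G"
    using tendsto_mult_left[OF tendsto_real_sqrt[OF lim], of "K powr (p - 1)"] by simp
  show "\<forall>\<^sub>F i in G. norm (\<integral>\<omega>. \<bar>A i \<omega>\<bar> powr p \<partial>N) \<le> K powr (p - 1) * sqrt (\<integral>\<omega>. (A i \<omega>)\<^sup>2 \<partial>N)"
    using A(1)
  proof eventually_elim
    case (elim i)
    note [measurable] = elim
    have K0: "0 \<le> K" using A(2)[of i undefined] by linarith
    have le: "\<bar>A i \<omega>\<bar> powr p \<le> K powr (p - 1) * \<bar>A i \<omega>\<bar>" for \<omega>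
    proof -
      have "\<bar>A i \<omega>\<bar> powr p = \<bar>A i \<omega>\<bar> powr (p - 1) * \<bar>A i \<omega>\<bar>"
        using powr_add[of "\<bar>A i \<omega>\<bar>" "p - 1" 1] by simp
      also have "\<dots> \<le> K powr (p - 1) * \<bar>A i \<omega>\<bar>"
        using p A(2)[of i \<omega>] by (intro mult_right_mono powr_mono2) auto
      finally show ?thesis .
    qed
    have int: "integrable N (\<lambda>\<omega>. \<bar>A i \<omega>\<bar>)" "integrable N (\<lambda>\<omega>. (A i \<omega>)\<^sup>2)"
      using A(2)[of i] K0 power_mono[OF A(2)[of i] abs_ge_zero, of _ 2]
      by (intro integrable_const_bound[where B=K] integrable_const_bound[where B="K\<^sup>2"]; force)+
    have "(\<integral>\<omega>. \<bar>A i \<omega>\<bar> powr p \<partial>N) \<le> (\<integral>\<omega>. K powr (p - 1) * \<bar>A i \<omega>\<bar> \<partial>N)"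
      using int le by (intro integral_mono') auto
    also have "\<dots> \<le> K powr (p - 1) * sqrt (\<integral>\<omega>. (A i \<omega>)\<^sup>2 \<partial>N)"
      \<comment> \<open>Nonnegativity of the variance of \<open>\<bar>A i\<bar>\<close> is the
        needed case of Cauchy-Schwarz.\<close>
      using variance_positive[of "\<lambda>\<omega>. \<bar>A i \<omega>\<bar>"] variance_eq[of "\<lambda>\<omega>. \<bar>A i \<omega>\<bar>"] int
      by (auto intro!: mult_left_mono real_le_rsqrt)
    finally show ?case by simp
  qed
qed

subsection \<open>The two time sets\<close>

lemma set_lebesgue_integral_restrict_space:
  fixes h :: "'a \<Rightarrow> real"
  assumes "A \<inter> space N \<in> sets N"
  shows "(LINT s:A|N. h s) = (\<integral>s. h s \<partial>restrict_space N A)"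
  unfolding set_lebesgue_integral_def using assms by (simp add: integral_restrict_space)

lemma restrict_time_count:
  "restrict_space (count_space \<nat>) {0..<real n} = count_space (real ` {..<n})"
proof -
  have "\<nat> \<inter> {0..<real n} = real ` {..<n}" by (auto elim!: Nats_cases)
  then show ?thesis by (simp add: restrict_count_space Int_commute)
qed

text \<open>These facts hide the difference between discrete and continuous time from the later
  argument. The window is half-open so that its mass is exactly \<open>t\<close> in both cases. The
  bound \<open>2 * d + 1\<close> counts the integers near \<open>s\<close> and also exceeds the
  length \<open>2 * d\<close> of the real interval.\<close>

lemma
  assumes "time_set T \<tau>" "t \<in> T"
  defines "\<nu> \<equiv> restrict_space \<tau> {0..<t}"
  shows space_restrict_time: "space \<nu> = T \<inter> {0..<t}" (is ?sp)
    and sets_restrict_time: "{0..<t} \<inter> space \<tau> \<in> sets \<tau>" (is ?sets)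
    and finite_restrict_time: "finite_measure \<nu>" (is ?fin)
    and measure_restrict_time: "measure \<nu> (space \<nu>) = t" (is ?mass)
    and borel_restrict_time: "(\<lambda>s. s) \<in> borel_measurable \<nu>" (is ?meas)
    and close_restrict_time: "s \<in> T \<Longrightarrow> measure \<nu> {r \<in> space \<nu>. \<bar>r - s\<bar> < real d} \<le> 2 * real d + 1" (is "PROP ?close")
proof -
  consider (discrete) n where "T = \<nat>" "\<tau> = count_space \<nat>" "t = real n"
    | (continuous) "T = {0..}" "\<tau> = restrict_space lborel {0..}" "0 \<le> t"
    using assms by (auto simp: time_set_def elim: Nats_cases)
  then have "?sp \<and> ?sets \<and> ?fin \<and> ?mass \<and> ?meas \<and> (s \<in> T \<longrightarrow> measure \<nu> {r \<in> space \<nu>. \<bar>r - s\<bar> < real d} \<le> 2 * real d + 1)"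
  proof cases
    case discrete
    have \<nu>: "\<nu> = count_space (real ` {..<n})"
      unfolding \<nu>_def discrete by (rule restrict_time_count)
    have "measure \<nu> {r \<in> space \<nu>. \<bar>r - s\<bar> < real d} \<le> 2 * real d + 1" if s: "s \<in> T"
    proof -
      obtain m where m: "s = real m" using s discrete by (auto elim: Nats_cases)
      \<comment> \<open>Subtraction of naturals is cut off at 0, which discards no time and keeps
        the cardinality at most \<open>2 * d + 1\<close>.\<close>
      have sub: "{r \<in> real ` {..<n}. \<bar>r - s\<bar> < real d} \<subseteq> real ` {m - d..m + d}"
        by (auto simp: m intro!: imageI)
      have "card {r \<in> real ` {..<n}. \<bar>r - s\<bar> < real d} \<le> card (real ` {m - d..m + d})"
        by (intro card_mono sub) auto
      also have "\<dots> \<le> 2 * d + 1" by (simp add: card_image)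
      finally show ?thesis by (simp add: \<nu> measure_count_space)
    qed
    moreover have "finite_measure \<nu>" unfolding \<nu> by (intro finite_measure_count_space) auto
    ultimately show ?thesis
      using discrete by (auto simp: \<nu> measure_count_space card_image elim!: Nats_cases)
  next
    case continuous
    have \<nu>: "\<nu> = restrict_space lborel {0..<t}"
      unfolding \<nu>_def continuous by (subst restrict_restrict_space) (auto intro!: arg_cong[where f="restrict_space lborel"])
    have meas: "measure \<nu> A = measure lborel A" if "A \<subseteq> {0..<t}" for A
      unfolding \<nu> using that by (intro measure_restrict_space) auto
    have sp: "space \<nu> = {0..<t}" by (simp add: \<nu> space_restrict_space)
    have "measure \<nu> {r \<in> space \<nu>. \<bar>r - s\<bar> < real d} \<le> 2 * real d + 1"
    proof -
      have "measure \<nu> {r \<in> space \<nu>. \<bar>r - s\<bar> < real d} = measure lborel {r \<in> {0..<t}. \<bar>r - s\<bar> < real d}"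
        by (subst meas) (auto simp: sp)
      also have "\<dots> \<le> measure lborel {s - real d..s + real d}"
        by (intro measure_mono_fmeasurable) (auto simp: fmeasurable_def)
      finally show ?thesis by simp
    qed
    moreover have "finite_measure \<nu>"
      unfolding \<nu> by (intro finite_measureI) (simp add: emeasure_restrict_space space_restrict_space continuous(3))
    moreover have "measure \<nu> (space \<nu>) = t" using continuous by (simp add: meas sp)
    moreover have "(\<lambda>s. s) \<in> borel_measurable \<nu>"
      unfolding \<nu> by (intro measurable_restrict_space1) simp
    ultimately show ?thesis
      using continuous by (auto simp: sp sets_restrict_space_iff space_restrict_space)
  qed
  then show ?sp ?sets ?fin ?mass ?meas "PROP ?close" by blast+
qed

subsection \<open>Decorrelation along a Markov process\<close>

context markov_process
begin

section \<open>Measurability of the kernel and of the transition function\<close>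

lemma space_P: "space (P x) = space \<F>"
  using sets_P by (rule sets_eq_imp_space_eq)

declare sets_P [measurable_cong]

lemma kernel_P: "P \<in> borel \<rightarrow>\<^sub>M prob_algebra \<F>"
proof (rule measurable_prob_algebraI)
  show "P \<in> borel \<rightarrow>\<^sub>M subprob_algebra \<F>"
  proof (rule measurable_subprob_algebra)
    fix B assume "B \<in> sets \<F>"
    from kernel_measurable[OF this] show "(\<lambda>x. emeasure (P x) B) \<in> borel_measurable borel"
      using prob_space_P by (simp add: finite_measure.emeasure_eq_measure prob_space.finite_measure)
  qed (auto simp: sets_P prob_space_P prob_space_imp_subprob_space)
qed (rule prob_space_P)

lemma M_measurable [measurable]: "t \<in> T \<Longrightarrow> M t \<in> \<F> \<rightarrow>\<^sub>M borel"
  using adapted filtration_sub by (blast intro: measurable_from_subalg)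

lemma kernel_transition:
  assumes "t \<in> T"
  shows "transition P M t \<in> borel \<rightarrow>\<^sub>M prob_algebra borel"
  unfolding transition_def
  using measurable_compose[OF kernel_P measurable_distr_prob_space[OF M_measurable[OF assms]]] .

lemma sets_transition [measurable_cong, simp]: "sets (transition P M t x) = sets borel"
  by (simp add: transition_def)

lemma prob_space_transition: "t \<in> T \<Longrightarrow> prob_space (transition P M t x)"
  unfolding transition_def
  by (intro prob_space.prob_space_distr prob_space_P) measurable

section \<open>The Markov property for integrals of bounded functions\<close>

lemma markov_emeasure:
  assumes st: "s \<in> T" "t \<in> T" "t + s \<in> T" and B: "B \<in> sets borel"
    and G: "G \<in> borel_measurable (\<F>t t)" "\<And>\<omega>. 0 \<le> G \<omega>" "\<And>\<omega>. G \<omega> \<le> K"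
  shows "(\<integral>\<^sup>+\<omega>. ennreal (G \<omega>) * indicator B (M (t + s) \<omega>) \<partial>P x)
    = (\<integral>\<^sup>+\<omega>. ennreal (G \<omega>) * emeasure (transition P M s (M t \<omega>)) B \<partial>P x)"
proof -
  interpret prob_space "P x" by (rule prob_space_P)
  have sub: "subalgebra (P x) (\<F>t t)"
    using filtration_sub[OF st(2)] by (simp add: subalgebra_def space_P sets_P)
  interpret finite_measure_subalgebra "P x" "\<F>t t"
    by unfold_locales (rule sub)
  note [measurable] = st kernel_transition[OF st(1)] B
  have G_P[measurable]: "G \<in> borel_measurable \<F>"
    using G(1) filtration_sub[OF st(2)] by (blast intro: measurable_from_subalg)
  let ?A = "{\<omega> \<in> space \<F>. M (t + s) \<omega> \<in> B}"
  let ?k = "\<lambda>\<omega>. measure (transition P M s (M t \<omega>)) B"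
  have k[measurable]: "?k \<in> borel_measurable \<F>" by measurable
  have K: "\<bar>G \<omega>\<bar> \<le> K" for \<omega> using G by (simp add: abs_of_nonneg)
  have iA: "integrable (P x) (\<lambda>\<omega>. G \<omega> * indicat_real ?A \<omega>)"
    using G by (intro integrable_const_bound[where B=K]) (auto simp: indicator_def K order_trans[OF G(2,3)])
  have ik: "integrable (P x) (\<lambda>\<omega>. G \<omega> * ?k \<omega>)"
  proof (intro integrable_const_bound[where B=K])
    have "\<bar>G \<omega> * ?k \<omega>\<bar> \<le> K" for \<omega>
      using mult_left_le[OF prob_space.prob_le_1[OF prob_space_transition[OF st(1)]] G(2)[of \<omega>]] G(2,3)[of \<omega>]
      by (simp add: abs_mult) (meson order_trans)
    then show "AE \<omega> in P x. norm (G \<omega> * ?k \<omega>) \<le> K" by simp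
  qed measurable
  \<comment> \<open>The weight \<open>G\<close> is determined by time \<open>t\<close>, so it passes
    through the conditional expectation, which \<open>markov\<close> then evaluates.\<close>
  have "(\<integral>\<omega>. G \<omega> * indicat_real ?A \<omega> \<partial>P x) = (\<integral>\<omega>. G \<omega> * real_cond_exp (P x) (\<F>t t) (indicat_real ?A) \<omega> \<partial>P x)"
    by (intro real_cond_exp_intg(2)[symmetric] iA G) measurable
  also have "\<dots> = (\<integral>\<omega>. G \<omega> * ?k \<omega> \<partial>P x)"
    using markov[OF st(1,2) B, of x] by (intro integral_cong_AE) auto
  finally have eq: "(\<integral>\<omega>. G \<omega> * indicat_real ?A \<omega> \<partial>P x) = (\<integral>\<omega>. G \<omega> * ?k \<omega> \<partial>P x)" .
  have "(\<integral>\<^sup>+\<omega>. ennreal (G \<omega>) * indicator B (M (t + s) \<omega>) \<partial>P x) = (\<integral>\<^sup>+\<omega>. ennreal (G \<omega> * indicat_real ?A \<omega>) \<partial>P x)"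
    by (intro nn_integral_cong) (auto simp: space_P indicator_def)
  also have "\<dots> = (\<integral>\<^sup>+\<omega>. ennreal (G \<omega> * ?k \<omega>) \<partial>P x)"
    using eq G by (subst (1 2) nn_integral_eq_integral) (auto intro: iA ik)
  also have "\<dots> = (\<integral>\<^sup>+\<omega>. ennreal (G \<omega>) * emeasure (transition P M s (M t \<omega>)) B \<partial>P x)"
    using G prob_space_transition[OF st(1)]
    by (simp add: ennreal_mult finite_measure.emeasure_eq_measure prob_space.finite_measure)
  finally show ?thesis .
qed

lemma markov_nn_integral:
  assumes st: "s \<in> T" "t \<in> T" "t + s \<in> T" and h: "h \<in> borel_measurable borel"
    and G: "G \<in> borel_measurable (\<F>t t)" "\<And>\<omega>. 0 \<le> G \<omega>" "\<And>\<omega>. G \<omega> \<le> K"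
  shows "(\<integral>\<^sup>+\<omega>. ennreal (G \<omega>) * h (M (t + s) \<omega>) \<partial>P x)
    = (\<integral>\<^sup>+\<omega>. ennreal (G \<omega>) * (\<integral>\<^sup>+y. h y \<partial>transition P M s (M t \<omega>)) \<partial>P x)"
proof -
  have G_P[measurable]: "G \<in> borel_measurable \<F>"
    using G(1) filtration_sub[OF st(2)] by (blast intro: measurable_from_subalg)
  note [measurable] = st h
  have tr[measurable]: "transition P M s \<in> borel \<rightarrow>\<^sub>M subprob_algebra borel"
    by (rule measurable_prob_algebraD[OF kernel_transition[OF st(1)]])
  \<comment> \<open>Absorbing the weight \<open>G\<close> into the measure turns the claim for all \<open>h\<close> into an equality of laws.\<close>
  define D where "D = density (P x) (\<lambda>\<omega>. ennreal (G \<omega>))"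
  have sets_D[measurable_cong]: "sets D = sets \<F>" by (simp add: D_def sets_P)
  have ne: "space (distr D borel (M t)) \<noteq> {}" by simp
  have "distr D borel (M (t + s)) = distr D borel (M t) \<bind> transition P M s"
  proof (rule measure_eqI)
    show "sets (distr D borel (M (t + s))) = sets (distr D borel (M t) \<bind> transition P M s)"
      by (subst sets_bind[where N=borel]) auto
    fix B assume "B \<in> sets (distr D borel (M (t + s)))"
    then have B[measurable]: "B \<in> sets borel" by simp
    have "emeasure (distr D borel (M (t + s))) B = (\<integral>\<^sup>+\<omega>. indicator B (M (t + s) \<omega>) \<partial>D)"
      using nn_integral_distr[of "M (t + s)" D borel "indicator B"] by simp
    also have "\<dots> = (\<integral>\<^sup>+\<omega>. ennreal (G \<omega>) * indicator B (M (t + s) \<omega>) \<partial>P x)"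
      unfolding D_def by (intro nn_integral_density) measurable
    also have "\<dots> = (\<integral>\<^sup>+\<omega>. ennreal (G \<omega>) * emeasure (transition P M s (M t \<omega>)) B \<partial>P x)"
      by (rule markov_emeasure[OF st B G])
    also have "\<dots> = (\<integral>\<^sup>+\<omega>. emeasure (transition P M s (M t \<omega>)) B \<partial>D)"
      unfolding D_def by (intro nn_integral_density[symmetric]) measurable
    also have "\<dots> = (\<integral>\<^sup>+y. emeasure (transition P M s y) B \<partial>distr D borel (M t))"
      by (intro nn_integral_distr[symmetric]) measurable
    also have "\<dots> = emeasure (distr D borel (M t) \<bind> transition P M s) B"
      by (intro emeasure_bind[symmetric, OF ne, where N=borel]) measurable
    finally show "emeasure (distr D borel (M (t + s))) B = emeasure (distr D borel (M t) \<bind> transition P M s) B" .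
  qed
  then have "(\<integral>\<^sup>+y. h y \<partial>distr D borel (M (t + s))) = (\<integral>\<^sup>+y. h y \<partial>(distr D borel (M t) \<bind> transition P M s))"
    by simp
  also have "\<dots> = (\<integral>\<^sup>+y. (\<integral>\<^sup>+z. h z \<partial>transition P M s y) \<partial>distr D borel (M t))"
    by (intro nn_integral_bind[where B=borel]) measurable
  finally have "(\<integral>\<^sup>+\<omega>. h (M (t + s) \<omega>) \<partial>D) = (\<integral>\<^sup>+\<omega>. (\<integral>\<^sup>+z. h z \<partial>transition P M s (M t \<omega>)) \<partial>D)"
    by (simp add: nn_integral_distr)
  then show ?thesis
    unfolding D_def by (simp add: nn_integral_density)
qed

lemma markov_integral_nonneg:
  fixes h :: "'a \<Rightarrow> real" and G :: "'w \<Rightarrow> real"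
  assumes st: "s \<in> T" "t \<in> T" "t + s \<in> T"
    and h: "h \<in> borel_measurable borel" "\<And>x. 0 \<le> h x" "\<And>x. h x \<le> L"
    and G: "G \<in> borel_measurable (\<F>t t)" "\<And>\<omega>. 0 \<le> G \<omega>" "\<And>\<omega>. G \<omega> \<le> K"
  shows "(\<integral>\<omega>. G \<omega> * h (M (t + s) \<omega>) \<partial>P x)
    = (\<integral>\<omega>. G \<omega> * (\<integral>y. h y \<partial>transition P M s (M t \<omega>)) \<partial>P x)"
proof -
  have [measurable]: "G \<in> borel_measurable \<F>"
    using G(1) filtration_sub[OF st(2)] by (blast intro: measurable_from_subalg)
  note [measurable] = st h(1) measurable_prob_algebraD[OF kernel_transition[OF st(1)]]
  have int_h: "integrable (transition P M s y) h" for y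
    using h by (intro finite_measure_integrable_bounded[where K=L] prob_space.finite_measure prob_space_transition st) auto
  have "(\<integral>\<omega>. G \<omega> * h (M (t + s) \<omega>) \<partial>P x) = enn2real (\<integral>\<^sup>+\<omega>. ennreal (G \<omega>) * ennreal (h (M (t + s) \<omega>)) \<partial>P x)"
    using G h by (subst integral_eq_nn_integral) (auto simp: ennreal_mult)
  also have "(\<integral>\<^sup>+\<omega>. ennreal (G \<omega>) * ennreal (h (M (t + s) \<omega>)) \<partial>P x)
    = (\<integral>\<^sup>+\<omega>. ennreal (G \<omega>) * (\<integral>\<^sup>+y. ennreal (h y) \<partial>transition P M s (M t \<omega>)) \<partial>P x)"
    using h(1) by (intro markov_nn_integral[OF st _ G]) measurable
  also have "\<dots> = (\<integral>\<^sup>+\<omega>. ennreal (G \<omega> * (\<integral>y. h y \<partial>transition P M s (M t \<omega>))) \<partial>P x)"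
    using G h int_h by (intro nn_integral_cong) (simp add: nn_integral_eq_integral ennreal_mult)
  also have "enn2real \<dots> = (\<integral>\<omega>. G \<omega> * (\<integral>y. h y \<partial>transition P M s (M t \<omega>)) \<partial>P x)"
    using G h by (subst integral_eq_nn_integral) auto
  finally show ?thesis .
qed

text \<open>Signed functions reduce to nonnegative ones by adding the constants \<open>K\<close> and
  \<open>L\<close>. Expanding the product leaves the claim together with terms that cancel.\<close>

lemma markov_integral:
  fixes h :: "'a \<Rightarrow> real" and G :: "'w \<Rightarrow> real"
  assumes st: "s \<in> T" "t \<in> T" "t + s \<in> T"
    and h: "h \<in> borel_measurable borel" "\<And>x. \<bar>h x\<bar> \<le> L"
    and G: "G \<in> borel_measurable (\<F>t t)" "\<And>\<omega>. \<bar>G \<omega>\<bar> \<le> K"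
  shows "(\<integral>\<omega>. G \<omega> * h (M (t + s) \<omega>) \<partial>P x)
    = (\<integral>\<omega>. G \<omega> * (\<integral>y. h y \<partial>transition P M s (M t \<omega>)) \<partial>P x)"
proof -
  interpret prob_space "P x" by (rule prob_space_P)
  have [measurable]: "G \<in> borel_measurable \<F>"
    using G(1) filtration_sub[OF st(2)] by (blast intro: measurable_from_subalg)
  note [measurable] = st h(1) measurable_prob_algebraD[OF kernel_transition[OF st(1)]]
  have K0: "0 \<le> K" using G(2)[of undefined] by linarith
  have int_h: "integrable (transition P M s y) h" for y
    using h by (intro finite_measure_integrable_bounded[where K=L] prob_space.finite_measure prob_space_transition st) auto
  define Q where "Q \<omega> = (\<integral>y. h y \<partial>transition P M s (M t \<omega>))" for \<omega>
  have Q_bound: "\<bar>Q \<omega>\<bar> \<le> L" for \<omega>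
    unfolding Q_def using h(2) by (intro prob_abs_integral_le prob_space_transition st) auto
  have [measurable]: "Q \<in> borel_measurable \<F>" unfolding Q_def by measurable
  have Q_L: "(\<integral>y. h y + L \<partial>transition P M s (M t \<omega>)) = Q \<omega> + L" for \<omega>
    using int_h prob_space.finite_measure[OF prob_space_transition[OF st(1)]]
    by (simp add: Q_def finite_measure.integrable_const prob_space.prob_space[OF prob_space_transition[OF st(1)]])
  let ?H = "\<lambda>\<omega>. h (M (t + s) \<omega>)"
  have int: "integrable (P x) G" "integrable (P x) ?H" "integrable (P x) Q"
      "integrable (P x) (\<lambda>\<omega>. G \<omega> * ?H \<omega>)" "integrable (P x) (\<lambda>\<omega>. G \<omega> * Q \<omega>)"
    using G(2) h(2) Q_bound K0
    by (auto intro: finite_measure_axioms intro!: finite_measure_integrable_bounded[where K=K and h=G]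
        finite_measure_integrable_bounded[where K=L and h="?H"] finite_measure_integrable_bounded[where K=L and h=Q]
        finite_measure_integrable_bounded[where K="K * L" and h="\<lambda>\<omega>. G \<omega> * ?H \<omega>"]
        finite_measure_integrable_bounded[where K="K * L" and h="\<lambda>\<omega>. G \<omega> * Q \<omega>"] mult_mono simp: abs_mult)
  have shift_le: "0 \<le> h y + L \<and> h y + L \<le> L + L" "0 \<le> G \<omega> + K \<and> G \<omega> + K \<le> K + K" for y \<omega>
    using h(2)[of y] G(2)[of \<omega>] by linarith+
  have "(\<integral>\<omega>. (G \<omega> + K) * (?H \<omega> + L) \<partial>P x) = (\<integral>\<omega>. (G \<omega> + K) * (Q \<omega> + L) \<partial>P x)"
    unfolding Q_L[symmetric] using h(1) G(1) shift_le
    by (intro markov_integral_nonneg[where K="K + K" and L="L + L"] st) auto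
  \<comment> \<open>The weight 1 gives equal means of \<open>?H\<close> and \<open>Q\<close>; this
    cancels the terms that carry the factor \<open>K\<close>.\<close>
  moreover have "(\<integral>\<omega>. 1 * (?H \<omega> + L) \<partial>P x) = (\<integral>\<omega>. 1 * (Q \<omega> + L) \<partial>P x)"
    unfolding Q_L[symmetric] using h(1) shift_le
    by (intro markov_integral_nonneg[where K=1 and L="L + L"] st) auto
  ultimately show ?thesis
    unfolding Q_def[symmetric] using int by (simp add: algebra_simps prob_space)
qed

section \<open>Covariances along the process\<close>

lemma autocovariance_le:
  fixes g :: "'a \<Rightarrow> real"
  assumes st: "s \<in> T" "t \<in> T" "t + s \<in> T"
    and g: "g \<in> borel_measurable borel" "\<And>x. \<bar>g x\<bar> \<le> K"
  shows "\<bar>\<integral>\<omega>. g (M t \<omega>) * g (M (t + s) \<omega>) \<partial>P x\<bar>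
    \<le> K * (\<integral>y. \<bar>\<integral>z. g z \<partial>transition P M s y\<bar> \<partial>transition P M t x)"
proof -
  interpret prob_space "P x" by (rule prob_space_P)
  note [measurable] = st g(1) measurable_prob_algebraD[OF kernel_transition[OF st(1)]]
  have K0: "0 \<le> K" using g(2)[of undefined] by linarith
  define Q where "Q y = (\<integral>z. g z \<partial>transition P M s y)" for y
  have [measurable]: "Q \<in> borel_measurable borel" unfolding Q_def by measurable
  have Q_bound: "\<bar>Q y\<bar> \<le> K" for y
    unfolding Q_def using g(2) by (intro prob_abs_integral_le prob_space_transition st) auto
  \<comment> \<open>Conditioning on time \<open>t\<close> replaces the later factor by
    \<open>Q (M t \<omega>)\<close>; the earlier one is then bounded by \<open>K\<close>, and what
    remains depends only on the law of \<open>M t\<close>.\<close>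
  have "(\<integral>\<omega>. g (M t \<omega>) * g (M (t + s) \<omega>) \<partial>P x) = (\<integral>\<omega>. g (M t \<omega>) * Q (M t \<omega>) \<partial>P x)"
    unfolding Q_def using g by (intro markov_integral[where K=K and L=K] st measurable_compose[OF adapted]) auto
  also have "\<bar>\<dots>\<bar> \<le> (\<integral>\<omega>. \<bar>g (M t \<omega>) * Q (M t \<omega>)\<bar> \<partial>P x)" by (rule integral_abs_bound)
  also have "\<dots> \<le> (\<integral>\<omega>. K * \<bar>Q (M t \<omega>)\<bar> \<partial>P x)"
    using g(2) Q_bound K0
    by (intro integral_mono integrable_const_bound[where B="K * K"])
      (auto simp: abs_mult intro!: mult_mono AE_I2)
  also have "\<dots> = K * (\<integral>y. \<bar>Q y\<bar> \<partial>transition P M t x)"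
    unfolding transition_def by (subst integral_distr) auto
  finally show ?thesis by (simp add: Q_def)
qed

text \<open>The threshold \<open>d\<close> does two jobs: a gap of at least \<open>d\<close> makes
  the \<pi>-mean of \<open>h u\<close> small, and an earlier time of at least \<open>d\<close> makes
  the law of \<open>M s\<close> close to \<pi>. The second choice does not depend on the gap,
  because one constant \<open>C\<close> serves every \<open>h u\<close>; it may depend on
  \<open>x\<close>.\<close>

lemma asymptotically_uncorrelated:
  fixes g :: "'a \<Rightarrow> real"
  assumes d1: "\<And>x y::'a. dist x y \<le> 1"
    and T: "\<And>s r. s \<in> T \<Longrightarrow> r \<in> T \<Longrightarrow> s \<le> r \<Longrightarrow> r - s \<in> T"
    and \<pi>: "prob_space \<pi>" "sets \<pi> = sets borel"
    and conv: "\<And>x. ((\<lambda>t. wasserstein_dist (transition P M t x) \<pi>) \<longlongrightarrow> 0) (inf at_top (principal T))"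
    and g: "L-lipschitz_on UNIV g" "(\<integral>y. g y \<partial>\<pi>) = 0"
    and lip: "\<And>t. t \<in> T \<Longrightarrow> C-lipschitz_on UNIV (\<lambda>x. \<integral>y. g y \<partial>transition P M t x)"
    and "0 < \<epsilon>"
  shows "\<exists>d::nat. \<forall>s\<in>T. \<forall>r\<in>T. real d \<le> s \<longrightarrow> s + real d \<le> r \<longrightarrow>
    \<bar>\<integral>\<omega>. g (M s \<omega>) * g (M r \<omega>) \<partial>P x\<bar> \<le> \<epsilon>"
proof -
  let ?F = "inf at_top (principal T)"
  define h where "h u y = \<bar>\<integral>z. g z \<partial>transition P M u y\<bar>" for u y
  define W where "W t y = wasserstein_dist (transition P M t y) \<pi>" for t y
  have L0: "0 \<le> L" using g(1) by (rule lipschitz_on_nonneg)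
  have g_bound: "\<bar>g y\<bar> \<le> L" for y
    using lipschitz_deviation_le[OF d1 \<pi> g(1), of y] g(2) by simp
  have h_lip: "C-lipschitz_on UNIV (h u)" if "u \<in> T" for u
    using lipschitz_onD[OF lip[OF that]] lipschitz_on_nonneg[OF lip[OF that]]
    by (intro lipschitz_onI) (auto simp: h_def dist_real_def intro: order_trans[OF abs_triangle_ineq3])
  \<comment> \<open>Since \<open>g\<close> has mean zero under \<pi>, its transition mean is itself
    a difference of integrals against the two measures.\<close>
  have h_le_W: "h u y \<le> L * W u y" if "u \<in> T" for u y
    using lipschitz_integral_diff_le_wasserstein[OF d1 prob_space_transition[OF that] sets_transition \<pi> g(1)] g(2)
    by (simp add: h_def W_def)
  have W_lim: "((\<lambda>t. W t y) \<longlongrightarrow> 0) ?F" for y using conv by (simp add: W_def)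
  have h_lim: "((\<lambda>u. h u y) \<longlongrightarrow> 0) ?F" for y
  proof (rule Lim_null_comparison)
    show "\<forall>\<^sub>F u in ?F. norm (h u y) \<le> L * W u y"
      using h_le_W by (auto simp: eventually_inf_principal h_def)
    show "((\<lambda>u. L * W u y) \<longlongrightarrow> 0) ?F" using tendsto_mult_left[OF W_lim, of L] by simp
  qed
  have h_bound: "\<bar>h u y\<bar> \<le> L" if "u \<in> T" for u y
    unfolding h_def using g_bound prob_abs_integral_le[OF prob_space_transition[OF that]] by simp
  have "((\<lambda>u. \<integral>y. h u y \<partial>\<pi>) \<longlongrightarrow> 0) ?F"
    using lipschitz_borel_measurable[OF h_lip]
    by (intro integral_tendsto_zero_within[OF prob_space.finite_measure[OF \<pi>(1)] _ h_bound h_lim])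
      (simp_all add: measurable_cong_sets[OF \<pi>(2) refl])
  then have "((\<lambda>u. L * (\<integral>y. h u y \<partial>\<pi>)) \<longlongrightarrow> 0) ?F" using tendsto_mult_left[of _ 0 ?F L] by simp
  then have "\<forall>\<^sub>F u in ?F. L * (\<integral>y. h u y \<partial>\<pi>) < \<epsilon> / 2" using \<open>0 < \<epsilon>\<close> by (intro order_tendstoD) auto
  then obtain N1 where N1: "\<And>u. u \<in> T \<Longrightarrow> N1 \<le> u \<Longrightarrow> L * (\<integral>y. h u y \<partial>\<pi>) < \<epsilon> / 2"
    by (auto simp: eventually_inf_principal eventually_at_top_linorder)
  have "((\<lambda>t. L * (C * W t x)) \<longlongrightarrow> 0) ?F" using tendsto_mult_left[OF W_lim, of "L * C"] by (simp add: mult.assoc)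
  then have "\<forall>\<^sub>F t in ?F. L * (C * W t x) < \<epsilon> / 2" using \<open>0 < \<epsilon>\<close> by (intro order_tendstoD) auto
  then obtain N2 where N2: "\<And>t. t \<in> T \<Longrightarrow> N2 \<le> t \<Longrightarrow> L * (C * W t x) < \<epsilon> / 2"
    by (auto simp: eventually_inf_principal eventually_at_top_linorder)
  obtain d :: nat where d: "max N1 N2 \<le> real d" using real_arch_simple by blast
  have "\<bar>\<integral>\<omega>. g (M s \<omega>) * g (M r \<omega>) \<partial>P x\<bar> \<le> \<epsilon>"
    if sr: "s \<in> T" "r \<in> T" "real d \<le> s" "s + real d \<le> r" for s r
  proof -
    define u where "u = r - s"
    have u: "u \<in> T" "s + u = r" "N1 \<le> u" using sr T[of s r] d by (auto simp: u_def)
    have "\<bar>\<integral>\<omega>. g (M s \<omega>) * g (M r \<omega>) \<partial>P x\<bar> \<le> L * (\<integral>y. h u y \<partial>transition P M s x)"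
      using autocovariance_le[OF u(1) sr(1) _ lipschitz_borel_measurable[OF g(1)] g_bound] u(2) sr(2)
      by (simp add: h_def)
    \<comment> \<open>Here \<open>h u\<close> is the test function that compares the law of
      \<open>M s\<close> with \<pi>.\<close>
    also have "(\<integral>y. h u y \<partial>transition P M s x) \<le> (\<integral>y. h u y \<partial>\<pi>) + C * W s x"
      using lipschitz_integral_diff_le_wasserstein[OF d1 prob_space_transition[OF sr(1)] sets_transition \<pi> h_lip[OF u(1)], of x]
      by (simp add: W_def)
    then have "L * (\<integral>y. h u y \<partial>transition P M s x) \<le> L * (\<integral>y. h u y \<partial>\<pi>) + L * (C * W s x)"
      using L0 by (metis mult_left_mono distrib_left)
    also have "\<dots> \<le> \<epsilon>" using N1[OF u(1,3)] N2[OF sr(1)] sr d by simp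
    finally show ?thesis .
  qed
  then show ?thesis by blast
qed

section \<open>Time averages from a fixed starting point\<close>

lemma measurable_path_restrict_time:
  assumes "time_set T \<tau>" "t \<in> T"
  shows "(\<lambda>(s, \<omega>). M s \<omega>) \<in> restrict_space \<tau> {0..<t} \<Otimes>\<^sub>M \<F> \<rightarrow>\<^sub>M borel"
proof -
  consider (discrete) n where "T = \<nat>" "\<tau> = count_space \<nat>" "t = real n"
    | (continuous) "T = {0..}" "\<tau> = restrict_space lborel {0..}" "0 \<le> t"
    using assms by (auto simp: time_set_def elim: Nats_cases)
  then show ?thesis
  proof cases
    case discrete
    \<comment> \<open>With countably many times, joint measurability follows from that of each
      \<open>M s\<close>.\<close>
    show ?thesis
      unfolding discrete restrict_time_count using discrete(1)
      by (intro measurable_pair_measure_countable1) (auto intro: M_measurable)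
  next
    case continuous
    have \<tau>: "restrict_space \<tau> {0..<t} = restrict_space lborel {0..<t}"
      unfolding continuous by (subst restrict_restrict_space) (auto intro!: arg_cong[where f="restrict_space lborel"])
    \<comment> \<open>Progressive measurability lives on the closed interval with
      \<open>\<F>t t\<close>; identity maps carry the half-open window and the finer \<F> into
      it.\<close>
    have "(\<lambda>s. s) \<in> restrict_space \<tau> {0..<t} \<rightarrow>\<^sub>M restrict_space borel {0..t}"
      unfolding \<tau> by (intro measurable_restrict_space2 measurable_restrict_space1) (auto simp: space_restrict_space)
    moreover have "(\<lambda>\<omega>. \<omega>) \<in> \<F> \<rightarrow>\<^sub>M \<F>t t"
      using filtration_sub[OF assms(2)] measurable_ident by (auto simp: subalgebra_def measurable_def)
    ultimately have "(\<lambda>(s, \<omega>). (s, \<omega>)) \<in> restrict_space \<tau> {0..<t} \<Otimes>\<^sub>M \<F> \<rightarrow>\<^sub>M restrict_space borel {0..t} \<Otimes>\<^sub>M \<F>t t"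
      by measurable
    from measurable_compose[OF this progressive[OF continuous(1,3)]]
    show ?thesis by (simp add: case_prod_beta')
  qed
qed

lemma time_average_second_moment:
  fixes g :: "'a \<Rightarrow> real"
  assumes d1: "\<And>x y::'a. dist x y \<le> 1"
    and time: "time_set T \<tau>"
    and \<pi>: "prob_space \<pi>" "sets \<pi> = sets borel"
    and conv: "\<And>x. ((\<lambda>t. wasserstein_dist (transition P M t x) \<pi>) \<longlongrightarrow> 0) (inf at_top (principal T))"
    and g: "L-lipschitz_on UNIV g" "(\<integral>y. g y \<partial>\<pi>) = 0"
    and lip: "\<And>t. t \<in> T \<Longrightarrow> C-lipschitz_on UNIV (\<lambda>x. \<integral>y. g y \<partial>transition P M t x)"
  shows "((\<lambda>t. \<integral>\<omega>. (1 / t * (\<integral>s. g (M s \<omega>) \<partial>restrict_space \<tau> {0..<t}))\<^sup>2 \<partial>P x) \<longlongrightarrow> 0) (inf at_top (principal T))"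
proof (rule tendstoI)
  fix \<epsilon> :: real assume \<epsilon>: "0 < \<epsilon>"
  have T_diff: "r - s \<in> T" if "s \<in> T" "r \<in> T" "s \<le> r" for s r
    using time that by (auto simp: time_set_def Nats_diff elim!: Nats_cases simp flip: of_nat_diff)
  obtain d :: nat where d: "\<And>s r. s \<in> T \<Longrightarrow> r \<in> T \<Longrightarrow> real d \<le> s \<Longrightarrow> s + real d \<le> r \<Longrightarrow>
    \<bar>\<integral>\<omega>. g (M s \<omega>) * g (M r \<omega>) \<partial>P x\<bar> \<le> \<epsilon> / 2"
    using asymptotically_uncorrelated[OF d1 T_diff \<pi> conv g lip, of "\<epsilon> / 2" x] \<epsilon> by auto
  \<comment> \<open>The coefficient of \<open>t\<close> in the second moment bound, with
    \<open>b = 2 * d + 1\<close>; dividing by the square of \<open>t\<close> leaves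
    \<open>\<epsilon> / 2 + B / t\<close>.\<close>
  define B where "B = 3 * L\<^sup>2 * (2 * real d + 1)"
  have g_bound: "\<bar>g y\<bar> \<le> L" for y
    using lipschitz_deviation_le[OF d1 \<pi> g(1), of y] g(2) by simp
  have "\<bar>\<integral>\<omega>. (1 / t * (\<integral>s. g (M s \<omega>) \<partial>restrict_space \<tau> {0..<t}))\<^sup>2 \<partial>P x\<bar> < \<epsilon>"
    \<comment> \<open>The 1 ensures \<open>t > 0\<close>. The summand \<open>+ 1\<close> makes
      \<open>t\<close> strictly larger than \<open>2 * B / \<epsilon>\<close>, so that
      \<open>B / t < \<epsilon> / 2\<close>.\<close>
    if t: "t \<in> T" "max 1 (2 * B / \<epsilon> + 1) \<le> t" for t
  proof -
    let ?\<nu> = "restrict_space \<tau> {0..<t}"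
    have tpos: "0 < t" and tB: "2 * B / \<epsilon> < t" using t by auto
    have "0 \<in> T" using time by (auto simp: time_set_def)
    have sp: "space ?\<nu> = T \<inter> {0..<t}" by (rule space_restrict_time[OF time t(1)])
    have m: "measure ?\<nu> (space ?\<nu>) = t" by (rule measure_restrict_time[OF time t(1)])
    have "(\<integral>\<omega>. (\<integral>s. g (M s \<omega>) \<partial>?\<nu>)\<^sup>2 \<partial>P x)
      \<le> \<epsilon> / 2 * (measure ?\<nu> (space ?\<nu>))\<^sup>2 + 3 * L\<^sup>2 * (2 * real d + 1) * measure ?\<nu> (space ?\<nu>)"
    proof (rule second_moment_integral_le)
      show "case_prod (\<lambda>s \<omega>. g (M s \<omega>)) \<in> borel_measurable (?\<nu> \<Otimes>\<^sub>M P x)"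
        using measurable_compose[OF measurable_path_restrict_time[OF time t(1)] lipschitz_borel_measurable[OF g(1)]]
        by (simp add: case_prod_beta' cong: measurable_cong_sets sets_pair_measure_cong)
      \<comment> \<open>Early times are those close to time 0, so the bound for close times covers
        them.\<close>
      have "{s \<in> space ?\<nu>. s < real d} = {s \<in> space ?\<nu>. \<bar>s - 0\<bar> < real d}" by (auto simp: sp)
      then show "measure ?\<nu> {s \<in> space ?\<nu>. s < real d} \<le> 2 * real d + 1"
        using close_restrict_time[OF time t(1) \<open>0 \<in> T\<close>, of d] by simp
      show "\<bar>\<integral>\<omega>. g (M s \<omega>) * g (M r \<omega>) \<partial>P x\<bar> \<le> \<epsilon> / 2"
        if "s \<in> space ?\<nu>" "r \<in> space ?\<nu>" "real d \<le> s" "s + real d \<le> r" for s r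
        using that by (intro d) (auto simp: sp)
    qed (use \<epsilon> close_restrict_time[OF time t(1)] in \<open>auto simp: sp prob_space_P g_bound intro!: finite_restrict_time borel_restrict_time time t\<close>)
    then have "(\<integral>\<omega>. (1 / t * (\<integral>s. g (M s \<omega>) \<partial>?\<nu>))\<^sup>2 \<partial>P x) \<le> (\<epsilon> / 2 * t\<^sup>2 + B * t) / t\<^sup>2"
      using tpos by (simp add: m B_def power_mult_distrib power_divide divide_right_mono)
    also have "\<dots> = \<epsilon> / 2 + B / t" using tpos by (simp add: field_simps power2_eq_square)
    also have "\<dots> < \<epsilon>" using tB tpos \<epsilon> by (simp add: field_simps)
    finally show ?thesis by simp
  qed
  then show "\<forall>\<^sub>F t in inf at_top (principal T). dist (\<integral>\<omega>. (1 / t * (\<integral>s. g (M s \<omega>) \<partial>restrict_space \<tau> {0..<t}))\<^sup>2 \<partial>P x) 0 < \<epsilon>"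
    unfolding eventually_inf_principal eventually_at_top_linorder
    by (auto intro!: exI[of _ "max 1 (2 * B / \<epsilon> + 1)"])
qed

end

section \<open>Arbitrary initial laws and convergence of all moments\<close>

theorem theorem1p6:
  fixes T :: "real set"
    and \<tau> :: "real measure"
    and \<F> :: "'w measure"
    and P :: "'a::polish_space \<Rightarrow> 'w measure"
    and \<F>t :: "real \<Rightarrow> 'w measure"
    and \<theta> :: "real \<Rightarrow> 'w \<Rightarrow> 'w"
    and M :: "real \<Rightarrow> 'w \<Rightarrow> 'a"
    and \<pi> \<mu> :: "'a measure"
    and p :: real
    and f :: "'a \<Rightarrow> real"
  assumes dist_le_1: "\<And>x y::'a. dist x y \<le> 1"
    and time: "time_set T \<tau>"
    and markov: "markov_process T \<F> P \<F>t \<theta> M"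
    and pi: "\<pi> \<in> space (prob_algebra borel)"
    and conv: "\<And>x. ((\<lambda>t. wasserstein_dist (transition P M t x) \<pi>) \<longlongrightarrow> 0) (inf at_top (principal T))"
    and lip: "\<And>g. g \<in> Lip \<Longrightarrow>
      \<exists>C. \<forall>t\<in>T. (\<lambda>x. \<integral>y. g y \<partial>transition P M t x) \<in> Lip \<and>
                lip_seminorm (\<lambda>x. \<integral>y. g y \<partial>transition P M t x) \<le> C"
    and p: "1 \<le> p"
    and f: "f \<in> Lip"
    and mu: "\<mu> \<in> space (prob_algebra borel)"
  shows "tendsto_Lp (\<mu> \<bind> P) p
           (\<lambda>t \<omega>. 1 / t * (LINT s:{0..<t}|\<tau>. f (M s \<omega>)))
           (\<lambda>\<omega>. \<integral>y. f y \<partial>\<pi>)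
           (inf at_top (principal T))"
proof -
  interpret markov_process T \<F> P \<F>t \<theta> M by (rule markov)
  let ?F = "inf at_top (principal T)"
  have \<pi>: "prob_space \<pi>" "sets \<pi> = sets borel" and \<mu>: "prob_space \<mu>" "sets \<mu> = sets borel"
    using pi mu by (auto simp: space_prob_algebra)
  have kernel: "P \<in> \<mu> \<rightarrow>\<^sub>M prob_algebra \<F>"
    using kernel_P \<mu>(2) by (simp cong: measurable_cong_sets)
  define N where "N = \<mu> \<bind> P"
  have N_alg: "prob_space N" "sets N = sets \<F>"
  proof -
    show "prob_space N"
      unfolding N_def using prob_space_P measurable_prob_algebraD[OF kernel]
      by (intro prob_space.prob_space_bind[OF \<mu>(1)]) auto
    show "sets N = sets \<F>"
      unfolding N_def using \<mu>(1) sets_P by (intro sets_bind) (auto dest: prob_space.not_empty)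
  qed
  interpret N: prob_space N by (rule N_alg)
  define c where "c = (\<integral>y. f y \<partial>\<pi>)"
  define L where "L = lip_seminorm f"
  define g where "g y = f y - c" for y
  have f_lip: "L-lipschitz_on UNIV f" unfolding L_def using f by (rule lipschitz_on_lip_seminorm)
  have g_lip: "L-lipschitz_on UNIV g"
    using lipschitz_onD[OF f_lip] lipschitz_on_nonneg[OF f_lip]
    by (intro lipschitz_onI) (auto simp: g_def dist_real_def)
  have g_mean: "(\<integral>y. g y \<partial>\<pi>) = 0"
    using lipschitz_integrable[OF dist_le_1 \<pi> f_lip] \<pi>(1)
    by (simp add: g_def c_def prob_space.prob_space prob_space.finite_measure finite_measure.integrable_const)
  have g_bound: "\<bar>g y\<bar> \<le> L" for y
    using lipschitz_deviation_le[OF dist_le_1 \<pi> f_lip] by (simp add: g_def c_def)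
  \<comment> \<open>The hypothesis on the transition function is applied to the centred
    \<open>g\<close> itself, so \<open>C\<close> is its constant, uniform in time.\<close>
  have "g \<in> Lip" using g_lip by (auto simp: Lip_def)
  from lip[OF this] obtain C where "\<And>t. t \<in> T \<Longrightarrow> (\<lambda>x. \<integral>y. g y \<partial>transition P M t x) \<in> Lip"
    "\<And>t. t \<in> T \<Longrightarrow> lip_seminorm (\<lambda>x. \<integral>y. g y \<partial>transition P M t x) \<le> C" by auto
  then have C: "C-lipschitz_on UNIV (\<lambda>x. \<integral>y. g y \<partial>transition P M t x)" if "t \<in> T" for t
    using that by (intro lipschitz_on_le[OF lipschitz_on_lip_seminorm])
  let ?\<nu> = "\<lambda>t. restrict_space \<tau> {0..<t}"
  \<comment> \<open>The value 0 off \<open>T\<close> makes the bound by \<open>L\<close> hold for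
    every real index, as \<open>powr_moment_tendsto_zero\<close> demands.\<close>
  define A where "A t \<omega> = (if t \<in> T then 1 / t * (\<integral>s. g (M s \<omega>) \<partial>?\<nu> t) else 0)" for t \<omega>
  define X where "X t \<omega> = 1 / t * (LINT s:{0..<t}|\<tau>. f (M s \<omega>))" for t \<omega>
  have T_nonneg: "0 \<le> s" if "s \<in> T" for s using time that by (auto simp: time_set_def elim!: Nats_cases)
  have path: "(\<lambda>(s, \<omega>). h (M s \<omega>)) \<in> borel_measurable (?\<nu> t \<Otimes>\<^sub>M \<F>)"
    if "t \<in> T" "h \<in> borel_measurable borel" for t and h :: "'a \<Rightarrow> real"
    using measurable_compose[OF measurable_path_restrict_time[OF time that(1)] that(2)] by (simp add: case_prod_beta')
  have avg_meas: "(\<lambda>\<omega>. \<integral>s. h (M s \<omega>) \<partial>?\<nu> t) \<in> borel_measurable \<F>"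
    if "t \<in> T" "h \<in> borel_measurable borel" for t and h :: "'a \<Rightarrow> real"
  proof -
    interpret finite_measure "?\<nu> t" by (rule finite_restrict_time[OF time that(1)])
    show ?thesis using measurable_pair_swap[OF path[OF that]] by (intro borel_measurable_lebesgue_integral) simp
  qed
  have A_meas: "A t \<in> borel_measurable \<F>" if "t \<in> T" for t
    unfolding A_def using that avg_meas[OF that lipschitz_borel_measurable[OF g_lip]] by simp
  have A_bound: "\<bar>A t \<omega>\<bar> \<le> L" for t \<omega>
  \<comment> \<open>At \<open>t = 0\<close> the factor \<open>1 / t\<close> is 0 by convention, and
    so is the average.\<close>
  proof (cases "t \<in> T \<and> t \<noteq> 0")
    case True
    have "\<bar>\<integral>s. g (M s \<omega>) \<partial>?\<nu> t\<bar> \<le> L * t"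
      using finite_abs_integral_le[OF finite_restrict_time[OF time], where h="\<lambda>s. g (M s \<omega>)", OF _ g_bound] True
      by (simp add: measure_restrict_time[OF time])
    then show ?thesis using True T_nonneg[of t] by (simp add: A_def abs_mult field_simps)
  qed (use lipschitz_on_nonneg[OF f_lip] in \<open>auto simp: A_def\<close>)
  have A2_bound: "(A t \<omega>)\<^sup>2 \<le> L\<^sup>2" for t \<omega> using power_mono[OF A_bound[of t \<omega>] abs_ge_zero, of 2] by simp
  have in_T: "\<forall>\<^sub>F t in ?F. t \<in> T \<and> 0 < t"
    by (auto simp: eventually_inf_principal intro: eventually_mono[OF eventually_gt_at_top[of 0]])
  have A2_lim: "((\<lambda>t. \<integral>\<omega>. (A t \<omega>)\<^sup>2 \<partial>N) \<longlongrightarrow> 0) ?F"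
  proof -
    have lim_x: "((\<lambda>t. \<integral>\<omega>. (A t \<omega>)\<^sup>2 \<partial>P x) \<longlongrightarrow> 0) ?F" for x
      using time_average_second_moment[OF dist_le_1 time \<pi> conv g_lip g_mean C, of x]
      by (rule Lim_transform_eventually) (use in_T in \<open>auto elim!: eventually_mono simp: A_def\<close>)
    have meas_x: "(\<lambda>x. \<integral>\<omega>. (A t \<omega>)\<^sup>2 \<partial>P x) \<in> borel_measurable \<mu>" if "t \<in> T" for t
      using A_meas[OF that] by (intro measurable_compose[OF measurable_prob_algebraD[OF kernel] integral_measurable_subprob_algebra]) measurable
    have bound_x: "\<bar>\<integral>\<omega>. (A t \<omega>)\<^sup>2 \<partial>P x\<bar> \<le> L\<^sup>2" for t x
      using A2_bound by (intro prob_abs_integral_le prob_space_P) simp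
    \<comment> \<open>Convergence from each starting point is integrated over \<mu>, dominated by
      the constant \<open>L\<^sup>2\<close>.\<close>
    have "((\<lambda>t. \<integral>x. (\<integral>\<omega>. (A t \<omega>)\<^sup>2 \<partial>P x) \<partial>\<mu>) \<longlongrightarrow> 0) ?F"
      by (rule integral_tendsto_zero_within[OF prob_space.finite_measure[OF \<mu>(1)] meas_x bound_x lim_x])
    then show ?thesis
    proof (rule Lim_transform_eventually)
      have "(\<integral>\<omega>. (A t \<omega>)\<^sup>2 \<partial>N) = (\<integral>x. (\<integral>\<omega>. (A t \<omega>)\<^sup>2 \<partial>P x) \<partial>\<mu>)" if "t \<in> T" for t
        unfolding N_def using A_meas[OF that] A2_bound
        by (intro integral_bind_prob_kernel[OF \<mu> kernel_P, where K="L\<^sup>2"]) auto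
      then show "\<forall>\<^sub>F t in ?F. (\<integral>x. (\<integral>\<omega>. (A t \<omega>)\<^sup>2 \<partial>P x) \<partial>\<mu>) = (\<integral>\<omega>. (A t \<omega>)\<^sup>2 \<partial>N)"
        using in_T by (auto elim!: eventually_mono)
    qed
  qed
  \<comment> \<open>The window has mass \<open>t\<close>, so for positive \<open>t\<close> the
    constant \<open>c\<close> averages to itself. Restricting to sample points makes the path
    measurable, hence integrable, which allows the splitting.\<close>
  have X_eq: "X t \<omega> = A t \<omega> + c" if t: "t \<in> T" "0 < t" and \<omega>: "\<omega> \<in> space N" for t \<omega>
  proof -
    interpret finite_measure "?\<nu> t" by (rule finite_restrict_time[OF time t(1)])
    have \<omega>\<F>: "\<omega> \<in> space \<F>" using \<omega> sets_eq_imp_space_eq[OF N_alg(2)] by simp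
    have "integrable (?\<nu> t) (\<lambda>s. g (M s \<omega>))"
      using g_bound measurable_Pair1[OF path[OF t(1) lipschitz_borel_measurable[OF g_lip]] \<omega>\<F>]
      by (intro finite_measure_integrable_bounded[where K=L] finite_measure_axioms) auto
    then have "(\<integral>s. f (M s \<omega>) \<partial>?\<nu> t) = (\<integral>s. g (M s \<omega>) \<partial>?\<nu> t) + c * t"
      using Bochner_Integration.integral_add[of "?\<nu> t" "\<lambda>s. g (M s \<omega>)" "\<lambda>_. c"]
      by (simp add: g_def measure_restrict_time[OF time t(1)] mult.commute)
    then show ?thesis
      using t by (simp add: X_def A_def set_lebesgue_integral_restrict_space[OF sets_restrict_time[OF time t(1)]] field_simps)
  qed
  have X_meas: "X t \<in> borel_measurable N" if "t \<in> T" for t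
    unfolding X_def set_lebesgue_integral_restrict_space[OF sets_restrict_time[OF time that]]
    using avg_meas[OF that lipschitz_borel_measurable[OF f_lip]] by (simp add: measurable_cong_sets[OF N_alg(2) refl])
  have "tendsto_Lp N p X (\<lambda>\<omega>. c) ?F"
    unfolding tendsto_Lp_def
  proof (intro conjI)
    show "in_Lp N p (\<lambda>\<omega>. c)" by (simp add: in_Lp_def)
    show "\<forall>\<^sub>F t in ?F. in_Lp N p (X t)"
      using in_T
    proof eventually_elim
      case (elim t)
      \<comment> \<open>Membership in \<open>L\<^sup>p\<close> comes from the uniform bound on
        \<open>X t\<close>, through its splitting into \<open>A t\<close> and
        \<open>c\<close>.\<close>
      have "\<bar>X t \<omega>\<bar> powr p \<le> (L + \<bar>c\<bar>) powr p" if "\<omega> \<in> space N" for \<omega>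
        using X_eq[OF _ _ that, of t] elim A_bound[of t \<omega>] p by (intro powr_mono2) auto
      then show ?case
        using X_meas elim unfolding in_Lp_def
        by (auto intro!: N.integrable_const_bound[where B="(L + \<bar>c\<bar>) powr p"] AE_I2)
    qed
    have "((\<lambda>t. \<integral>\<omega>. \<bar>A t \<omega>\<bar> powr p \<partial>N) \<longlongrightarrow> 0) ?F"
      using A_meas A_bound A2_lim p in_T
      by (intro powr_moment_tendsto_zero N_alg) (auto elim!: eventually_mono simp: measurable_cong_sets[OF N_alg(2) refl])
    then have "((\<lambda>t. Lp_norm N p (A t)) \<longlongrightarrow> 0) ?F"
      unfolding Lp_norm_def using p by (intro tendsto_zero_powrI[OF _ tendsto_const]) auto
    then show "((\<lambda>t. Lp_norm N p (\<lambda>\<omega>. X t \<omega> - c)) \<longlongrightarrow> 0) ?F"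
    proof (rule Lim_transform_eventually)
      show "\<forall>\<^sub>F t in ?F. Lp_norm N p (A t) = Lp_norm N p (\<lambda>\<omega>. X t \<omega> - c)"
        using in_T by eventually_elim (auto simp: Lp_norm_def X_eq cong: Bochner_Integration.integral_cong)
    qed
  qed
  then show ?thesis by (simp add: N_def X_def[abs_def] c_def)
qed

end
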